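(* Let $\theta$ be a measure preserving transformation of a measure space $(X,\Sigma,\nu)$. Let $f\in L^2(\nu)$ be such that $$\sum_{n\ge 3}\frac{\log n\,\big\|\sum_{k=1}^nf\circ\theta^k\big\|_{L^2(\nu)}^2}{n^2}<+\infty .$$ Then $$\frac{1}{\sqrt{n\log\log n}}\sum_{k=1}^nf\circ\theta^k\longrightarrow 0\qquad\nu\text{-a.s. as } n\to+\infty .$$ *)

theory Defs
  imports "HOL-Analysis.Analysis"
begin

definition measure_preserving :: "'a measure \<Rightarrow> ('a \<Rightarrow> 'a) \<Rightarrow> bool" where
  "measure_preserving M \<theta> \<longleftrightarrow>
     \<theta> \<in> measurable M M \<and>
     (\<forall>A\<in>sets M. emeasure M (\<theta> -` A \<inter> space M) = emeasure M A)"

(* Elements of L^2 are represented by functions rather than by classes modulo null sets. *)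
definition in_L2 :: "'a measure \<Rightarrow> ('a \<Rightarrow> 'b::real_normed_vector) \<Rightarrow> bool" where
  "in_L2 M f \<longleftrightarrow> f \<in> borel_measurable M \<and> integrable M (\<lambda>x. (norm (f x))\<^sup>2)"

(* Only meaningful under in_L2: the integral of a non-integrable function is 0. *)
definition L2_norm :: "'a measure \<Rightarrow> ('a \<Rightarrow> 'b::real_normed_vector) \<Rightarrow> real" where
  "L2_norm M f = sqrt (\<integral>x. (norm (f x))\<^sup>2 \<partial>M)"

(* The sum starts at k = 1: the term f itself is not included. *)
definition ergodic_sum :: "('a \<Rightarrow> 'a) \<Rightarrow> ('a \<Rightarrow> 'b::comm_monoid_add) \<Rightarrow> nat \<Rightarrow> 'a \<Rightarrow> 'b" where
  "ergodic_sum \<theta> f n x = (\<Sum>k=1..n. f ((\<theta> ^^ k) x))"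

end

theory Submission
  imports Defs "HOL-Real_Asymp.Real_Asymp"
begin

text \<open>
  Write \<open>S\<^sub>n\<close> for the ergodic sum of length \<open>n\<close>, so that
  \<open>S\<^sub>m\<^sub>+\<^sub>n = S\<^sub>m + S\<^sub>n \<circ> \<theta>\<^sup>m\<close>.
  Everything reduces to the nonnegative functions
  \<open>w\<^sub>j = (j + 1) 2\<^sup>-\<^sup>j |S\<^sub>L|\<^sup>2\<close> with \<open>L = 2\<^sup>j\<close>, through three facts.

  The series of the integrals of \<open>w\<^sub>j\<close> converges. The additivity of \<open>S\<close> shows that the norm of
  \<open>S\<^sub>L\<close> is controlled by those of \<open>S\<^sub>k\<close> and \<open>S\<^sub>k\<^sub>+\<^sub>L\<close> for every \<open>k\<close>; averaging over \<open>k\<close> between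
  \<open>L\<close> and \<open>2 L\<close> compares the \<open>j\<close>-th integral with two dyadic blocks of the given series
  (\<open>summable_dyadic_of_quasi_subadditive\<close>).

  Along each orbit, chaining compares the value of \<open>S\<close> at one time with its averages over larger and
  larger dyadic intervals. Two neighbouring intervals of length \<open>L\<close> contribute at most the square
  root of \<open>1 / L\<close> times a sum of \<open>|S\<^sub>L|\<^sup>2\<close> along the orbit
  (\<open>norm_diff_le_sum_dyadic_increments\<close>). The Cauchy-Schwarz inequality with the weights
  \<open>j + 1\<close> bounds the sum of the first \<open>r\<close> contributions, for times below \<open>N = 2\<^sup>r\<close>, by the square
  root of \<open>(1 + ln r) N\<close> times that of an average of \<open>\<Sum>\<^sub>j w\<^sub>j\<close> along the orbit; as \<open>ln r\<close> is of
  order \<open>ln (ln N)\<close>, this is the required normalisation.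

  The maximal ergodic inequality makes these averages bounded almost everywhere, since \<open>\<Sum>\<^sub>j w\<^sub>j\<close>
  is integrable. This alone bounds the normalised sums. For the limit \<open>0\<close>, the scales below
  a fixed \<open>J\<close> are treated separately: they produce no factor \<open>ln r\<close> and so vanish after normalisation,
  whereas the maximal inequality for the tail \<open>\<Sum>\<^sub>j\<^sub>\<ge>\<^sub>J w\<^sub>j\<close>, whose integral is small, makes the
  remaining scales small uniformly in time (\<open>tendsto_zero_of_dyadic_energy\<close>,
  \<open>AE_exists_small_tail_average\<close>).
\<close>

section \<open>Measure preserving maps\<close>

lemma measure_preserving_funpow:
  assumes "measure_preserving M \<theta>"
  shows "measure_preserving M (\<theta> ^^ k)"
proof (induction k)
  case 0
  show ?case
    by (auto simp: measure_preserving_def vimage_def intro!: arg_cong[where f = "emeasure M"]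
             dest: sets.sets_into_space)
next
  case (Suc k)
  have m: "\<theta> \<in> measurable M M" "(\<theta> ^^ k) \<in> measurable M M"
    using assms Suc by (auto simp: measure_preserving_def)
  have "emeasure M ((\<theta> ^^ Suc k) -` A \<inter> space M) = emeasure M A" if A: "A \<in> sets M" for A
  proof -
    have "(\<theta> ^^ Suc k) -` A \<inter> space M = (\<theta> ^^ k) -` (\<theta> -` A \<inter> space M) \<inter> space M"
      using measurable_space[OF m(2)] by auto
    also have "emeasure M \<dots> = emeasure M (\<theta> -` A \<inter> space M)"
      using Suc measurable_sets[OF m(1) A] by (auto simp: measure_preserving_def)
    also have "\<dots> = emeasure M A"
      using assms A by (auto simp: measure_preserving_def)
    finally show ?thesis .
  qed
  then show ?case
    using measurable_comp[OF m(2) m(1)] by (simp add: measure_preserving_def comp_def)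
qed

lemma measurable_measure_preserving_funpow:
  "measure_preserving M \<theta> \<Longrightarrow> (\<theta> ^^ k) \<in> measurable M M"
  using measure_preserving_funpow[of M \<theta> k] by (simp add: measure_preserving_def)

lemma distr_measure_preserving_funpow:
  assumes "measure_preserving M \<theta>"
  shows "distr M M (\<theta> ^^ k) = M"
  using measure_preserving_funpow[OF assms, of k] measurable_measure_preserving_funpow[OF assms]
  by (intro measure_eqI) (auto simp: measure_preserving_def emeasure_distr)

lemma nn_integral_measure_preserving_funpow:
  assumes "measure_preserving M \<theta>" "u \<in> borel_measurable M"
  shows "(\<integral>\<^sup>+x. u ((\<theta> ^^ k) x) \<partial>M) = (\<integral>\<^sup>+x. u x \<partial>M)"
  using nn_integral_distr[OF measurable_measure_preserving_funpow[OF assms(1), of k], of u] assms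
  by (simp add: distr_measure_preserving_funpow)

lemma integrable_measure_preserving_funpow:
  fixes u :: "'a \<Rightarrow> real"
  assumes "measure_preserving M \<theta>" "integrable M u"
  shows "integrable M (\<lambda>x. u ((\<theta> ^^ k) x))"
  using integrable_distr_eq[OF measurable_measure_preserving_funpow[OF assms(1), of k], of u] assms
  by (simp add: distr_measure_preserving_funpow)

lemma integral_measure_preserving_funpow:
  fixes u :: "'a \<Rightarrow> real"
  assumes "measure_preserving M \<theta>" "u \<in> borel_measurable M"
  shows "(\<integral>x. u ((\<theta> ^^ k) x) \<partial>M) = (\<integral>x. u x \<partial>M)"
  using integral_distr[OF measurable_measure_preserving_funpow[OF assms(1), of k], of u] assms
  by (simp add: distr_measure_preserving_funpow)

section \<open>The maximal ergodic inequality\<close>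

text \<open>
  The covering argument behind the maximal inequality. The set \<open>E\<close> consists of times from which
  some window of length at most \<open>N\<close> has average at least \<open>l\<close>. Scanning from \<open>a\<close>, one skips a time
  outside \<open>E\<close> and jumps over the window attached to a time in \<open>E\<close>; the windows chosen are disjoint
  and cover \<open>E\<close>. The last one may overshoot the interval by up to \<open>N\<close>, hence \<open>L + N\<close> on the right.
\<close>

lemma sum_covering_bound:
  fixes u :: "nat \<Rightarrow> ennreal" and l :: ennreal
  assumes E: "\<And>m. m \<in> E \<Longrightarrow> \<exists>n\<in>{1..N}. of_nat n * l \<le> (\<Sum>i<n. u (m + i))"
  shows "of_nat (card (E \<inter> {a..<a + L})) * l \<le> (\<Sum>m\<in>{a..<a + (L + N)}. u m)"
proof (induction L arbitrary: a rule: less_induct)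
  case (less L)
  show ?case
  proof (cases "L = 0")
    case True
    then show ?thesis by simp
  next
    case False
    \<comment> \<open>One step of the scan; \<open>n = 1\<close> also serves a time outside \<open>E\<close>, even if \<open>N = 0\<close>.\<close>
    have "\<exists>n\<in>{1..N + 1}. n \<le> L + N \<and>
        of_nat (card (E \<inter> {a..<a + min n L})) * l \<le> (\<Sum>i\<in>{a..<a + n}. u i)"
    proof (cases "a \<in> E")
      case True
      then obtain n where n: "n \<in> {1..N}" "of_nat n * l \<le> (\<Sum>i<n. u (a + i))"
        using E by blast
      have "card (E \<inter> {a..<a + min n L}) \<le> card {a..<a + min n L}"
        by (intro card_mono) auto
      then have "card (E \<inter> {a..<a + min n L}) \<le> n"
        by simp
      then have "of_nat (card (E \<inter> {a..<a + min n L})) * l \<le> of_nat n * l"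
        by (intro mult_right_mono) auto
      also note n(2)
      also have "(\<Sum>i<n. u (a + i)) = (\<Sum>i\<in>{a..<a + n}. u i)"
        by (rule sum.reindex_bij_witness[where i = "\<lambda>i. i - a" and j = "\<lambda>i. a + i"]) auto
      finally show ?thesis using n by (intro bexI[of _ n]) auto
    next
      case aE: False
      have "{a..<a + min 1 L} = {a}"
        using False by auto
      then have "E \<inter> {a..<a + min 1 L} = {}"
        using aE by auto
      then show ?thesis
        using False by (intro bexI[of _ 1]) simp_all
    qed
    then obtain n where n: "1 \<le> n" "n \<le> L + N"
      "of_nat (card (E \<inter> {a..<a + min n L})) * l \<le> (\<Sum>i\<in>{a..<a + n}. u i)"
      by auto
    show ?thesis
    proof (cases "n < L")
      case True
      have "E \<inter> {a..<a + L} = (E \<inter> {a..<a + n}) \<union> (E \<inter> {a + n..<(a + n) + (L - n)})"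
        using True by auto
      then have "card (E \<inter> {a..<a + L})
          \<le> card (E \<inter> {a..<a + n}) + card (E \<inter> {a + n..<(a + n) + (L - n)})"
        by (metis card_Un_le)
      then have "of_nat (card (E \<inter> {a..<a + L})) * l
          \<le> of_nat (card (E \<inter> {a..<a + n}) + card (E \<inter> {a + n..<(a + n) + (L - n)})) * l"
        by (intro mult_right_mono of_nat_mono) auto
      also have "\<dots> = of_nat (card (E \<inter> {a..<a + n})) * l
          + of_nat (card (E \<inter> {a + n..<(a + n) + (L - n)})) * l"
        by (simp add: algebra_simps)
      also have "\<dots> \<le> (\<Sum>i\<in>{a..<a + n}. u i) + (\<Sum>m\<in>{a + n..<(a + n) + (L - n + N)}. u m)"
        using n True less.IH[of "L - n" "a + n"] by (intro add_mono) auto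
      also have "\<dots> = (\<Sum>m\<in>{a..<a + (L + N)}. u m)"
        using True by (subst sum.atLeastLessThan_concat) auto
      finally show ?thesis .
    next
      case False
      then have "of_nat (card (E \<inter> {a..<a + L})) * l \<le> (\<Sum>i\<in>{a..<a + n}. u i)"
        using n(3) by (simp add: min_def split: if_splits)
      also have "\<dots> \<le> (\<Sum>m\<in>{a..<a + (L + N)}. u m)"
        using n by (intro sum_mono2) auto
      finally show ?thesis .
    qed
  qed
qed

lemma ennreal_le_of_mult_le_add:
  fixes c I :: ennreal
  assumes "\<And>L::nat. of_nat L * c \<le> of_nat (L + N) * I"
  shows "c \<le> I"
proof (cases "I = \<infinity>")
  case False
  have "c \<le> of_nat (1 + N) * I"
    using assms[of 1] by simp
  also have "\<dots> < \<infinity>"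
    using False by (simp add: ennreal_mult_less_top top.not_eq_extremum ennreal_of_nat_eq_real_of_nat
        del: of_nat_add)
  finally have c: "c \<noteq> \<infinity>" by auto
  obtain c' where c': "c = ennreal c'" "0 \<le> c'"
    using c by (cases c) auto
  obtain I' where I': "I = ennreal I'" "0 \<le> I'"
    using False by (cases I) auto
  have le: "real L * c' \<le> real (L + N) * I'" for L
    using assms[of L] c' I'
    by (simp add: ennreal_of_nat_eq_real_of_nat ennreal_mult[symmetric] del: of_nat_add)
  have "c' \<le> I'"
  proof (rule ccontr)
    assume "\<not> c' \<le> I'"
    then have "0 < c' - I'" by simp
    from reals_Archimedean3[OF this] obtain L :: nat where "real N * I' < real L * (c' - I')"
      by blast
    with le[of L] show False by (simp add: algebra_simps)
  qed
  then show ?thesis using c' I' by simp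
qed simp

text \<open>
  Integrating the covering bound along orbits over \<open>L\<close> steps gives \<open>L\<close> times the left-hand side at
  most \<open>L + N\<close> times the right-hand side, because all \<open>\<theta>\<^sup>m\<close> preserve the measure; the excess \<open>N\<close>
  disappears as \<open>L\<close> grows. Extended nonnegative functions let the same
  argument cover measures of infinite total mass.
\<close>

lemma maximal_ergodic_inequality_finite:
  fixes u :: "'a \<Rightarrow> ennreal"
  assumes mp: "measure_preserving M \<theta>" and u[measurable]: "u \<in> borel_measurable M"
  shows "l * emeasure M {x\<in>space M. \<exists>n\<in>{1..N}. of_nat n * l < (\<Sum>i<n. u ((\<theta> ^^ i) x))}
           \<le> (\<integral>\<^sup>+x. u x \<partial>M)"
proof -
  define E where "E = {x\<in>space M. \<exists>n\<in>{1..N}. of_nat n * l < (\<Sum>i<n. u ((\<theta> ^^ i) x))}"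
  note [measurable] = measurable_measure_preserving_funpow[OF mp]
  have E[measurable]: "E \<in> sets M"
    unfolding E_def by measurable
  have "of_nat L * (l * emeasure M E) \<le> of_nat (L + N) * (\<integral>\<^sup>+x. u x \<partial>M)" for L
  proof -
    have "of_nat L * (l * emeasure M E) = (\<Sum>m<L. l * (\<integral>\<^sup>+x. indicator E ((\<theta> ^^ m) x) \<partial>M))"
      using nn_integral_measure_preserving_funpow[OF mp, of "indicator E"] by simp
    also have "\<dots> = (\<integral>\<^sup>+x. (\<Sum>m<L. l * indicator E ((\<theta> ^^ m) x)) \<partial>M)"
      by (subst nn_integral_sum) (auto simp: nn_integral_cmult)
    also have "\<dots> \<le> (\<integral>\<^sup>+x. (\<Sum>m<L + N. u ((\<theta> ^^ m) x)) \<partial>M)"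
    proof (intro nn_integral_mono)
      fix x assume "x \<in> space M"
      define F where "F = {m. (\<theta> ^^ m) x \<in> E}"
      have "\<exists>n\<in>{1..N}. of_nat n * l \<le> (\<Sum>i<n. u ((\<theta> ^^ (m + i)) x))" if "m \<in> F" for m
        using that unfolding F_def E_def
        by (force simp: funpow_add add.commute[of m] intro: less_imp_le)
      from sum_covering_bound[of F N l "\<lambda>m. u ((\<theta> ^^ m) x)" 0 L, OF this]
      have "of_nat (card (F \<inter> {..<L})) * l \<le> (\<Sum>m<L + N. u ((\<theta> ^^ m) x))"
        by (simp add: atLeast0LessThan)
      moreover have "(\<Sum>m<L. l * indicator E ((\<theta> ^^ m) x)) = of_nat (card (F \<inter> {..<L})) * l"
      proof -
        have "(\<Sum>m<L. l * indicator E ((\<theta> ^^ m) x)) = (\<Sum>m<L. l * indicator F m)"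
          by (intro sum.cong) (auto simp: F_def indicator_def)
        also have "\<dots> = l * (\<Sum>m<L. indicator F m)"
          by (rule sum_distrib_left[symmetric])
        also have "(\<Sum>m<L. indicator F m :: ennreal) = of_nat (card (F \<inter> {..<L}))"
          by (simp add: indicator_def Int_commute)
        also have "l * \<dots> = \<dots> * l"
          by (rule mult.commute)
        finally show ?thesis .
      qed
      ultimately show "(\<Sum>m<L. l * indicator E ((\<theta> ^^ m) x)) \<le> (\<Sum>m<L + N. u ((\<theta> ^^ m) x))"
        by simp
    qed
    also have "\<dots> = (\<Sum>m<L + N. \<integral>\<^sup>+x. u ((\<theta> ^^ m) x) \<partial>M)"
      by (subst nn_integral_sum) auto
    also have "\<dots> = of_nat (L + N) * (\<integral>\<^sup>+x. u x \<partial>M)"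
      using nn_integral_measure_preserving_funpow[OF mp u] by simp
    finally show ?thesis .
  qed
  from ennreal_le_of_mult_le_add[OF this] show ?thesis
    by (simp add: E_def)
qed

lemma maximal_ergodic_inequality:
  fixes u :: "'a \<Rightarrow> ennreal"
  assumes mp: "measure_preserving M \<theta>" and u[measurable]: "u \<in> borel_measurable M"
  shows "l * emeasure M {x\<in>space M. \<exists>n\<ge>1. of_nat n * l < (\<Sum>i<n. u ((\<theta> ^^ i) x))}
           \<le> (\<integral>\<^sup>+x. u x \<partial>M)"
proof -
  note [measurable] = measurable_measure_preserving_funpow[OF mp]
  define E where "E N = {x\<in>space M. \<exists>n\<in>{1..N}. of_nat n * l < (\<Sum>i<n. u ((\<theta> ^^ i) x))}" for N :: nat
  have E: "range E \<subseteq> sets M"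
    unfolding E_def by auto
  have inc: "incseq E"
    unfolding E_def incseq_def by force
  have UN: "(\<Union>N. E N) = {x\<in>space M. \<exists>n\<ge>1. of_nat n * l < (\<Sum>i<n. u ((\<theta> ^^ i) x))}"
    unfolding E_def by force
  have "l * (SUP N. emeasure M (E N)) \<le> (\<integral>\<^sup>+x. u x \<partial>M)"
    using maximal_ergodic_inequality_finite[OF mp u]
    by (subst SUP_mult_left_ennreal) (auto intro!: SUP_least simp: E_def)
  then show ?thesis
    unfolding UN[symmetric] using SUP_emeasure_incseq[OF E inc] by simp
qed

text \<open>
  The exceptional set lies in the bad set of every pair \<open>(u i, l i)\<close>, so the maximal inequality bounds
  its measure by every ratio of the integral of \<open>u i\<close> to \<open>l i\<close>. Both increasing thresholds for a fixed
  function and a fixed threshold for shrinking functions make these ratios arbitrarily small.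
\<close>

lemma AE_exists_ergodic_average_bound:
  fixes u :: "nat \<Rightarrow> 'a \<Rightarrow> ennreal" and l :: "nat \<Rightarrow> real"
  assumes mp: "measure_preserving M \<theta>" and u[measurable]: "\<And>i. u i \<in> borel_measurable M"
    and l: "\<And>i. 0 < l i"
    and small: "\<And>e. 0 < e \<Longrightarrow> \<exists>i. (\<integral>\<^sup>+x. u i x \<partial>M) \<le> ennreal (e * l i)"
  shows "AE x in M. \<exists>i. \<forall>n\<ge>1. (\<Sum>m<n. u i ((\<theta> ^^ m) x)) \<le> ennreal (real n * l i)"
proof -
  note [measurable] = measurable_measure_preserving_funpow[OF mp]
  define B where "B i = {x\<in>space M. \<exists>n\<ge>1. of_nat n * ennreal (l i) < (\<Sum>m<n. u i ((\<theta> ^^ m) x))}" for i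
  have B[measurable]: "B i \<in> sets M" for i
    unfolding B_def by measurable
  define A where "A = (\<Inter>i. B i)"
  have A: "A \<in> sets M"
    unfolding A_def by measurable
  have "emeasure M A \<le> ennreal e" if e: "0 < e" for e
  proof -
    obtain i where i: "(\<integral>\<^sup>+x. u i x \<partial>M) \<le> ennreal (e * l i)"
      using small[OF e] by blast
    have "ennreal (l i) * emeasure M A \<le> ennreal (l i) * emeasure M (B i)"
      by (intro mult_left_mono emeasure_mono) (auto simp: A_def)
    also have "\<dots> \<le> ennreal (e * l i)"
      using maximal_ergodic_inequality[OF mp u, of "ennreal (l i)" i] i by (simp add: B_def)
    also have "\<dots> = ennreal (l i) * ennreal e"
      using e l[of i] by (simp add: ennreal_mult mult.commute)
    finally show ?thesis
      using l[of i] by (subst (asm) ennreal_mult_le_mult_iff) auto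
  qed
  then have "emeasure M A = 0"
    by (metis ennreal_le_epsilon le_zero_eq add_0 zero_less_one)
  then have "A \<in> null_sets M"
    using A by auto
  moreover have "{x\<in>space M. \<not> (\<exists>i. \<forall>n\<ge>1. (\<Sum>m<n. u i ((\<theta> ^^ m) x)) \<le> ennreal (real n * l i))} \<subseteq> A"
    unfolding A_def B_def
    using l by (auto simp: not_le ennreal_mult less_imp_le ennreal_of_nat_eq_real_of_nat)
  ultimately show ?thesis
    by (rule AE_I')
qed

section \<open>Dyadic chaining\<close>

text \<open>
  Pairing the points of two adjacent intervals at distance exactly \<open>L\<close> means that only increments of
  lag \<open>L\<close> enter. Jensen's inequality turns the mean increment into a mean square, and the sum over the
  interval is then enlarged to the whole range \<open>{..<T}\<close> so that the bound is independent of \<open>b\<close>.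
\<close>

lemma norm_avg_diff_le:
  fixes z :: "nat \<Rightarrow> 'b::real_normed_vector"
  assumes "b + L \<le> T" "0 < L"
  shows "norm ((\<Sum>i<L. z (b + L + i)) - (\<Sum>i<L. z (b + i))) / real L
           \<le> sqrt ((\<Sum>m<T. (norm (z (m + L) - z m))\<^sup>2) / real L)"
proof -
  have "(norm ((\<Sum>i<L. z (b + L + i)) - (\<Sum>i<L. z (b + i))))\<^sup>2
      \<le> (\<Sum>i<L. norm (z (b + i + L) - z (b + i)))\<^sup>2"
    unfolding sum_subtractf[symmetric]
    by (intro power_mono order.trans[OF norm_sum]) (auto simp: add_ac)
  also have "\<dots> \<le> real L * (\<Sum>i<L. (norm (z (b + i + L) - z (b + i)))\<^sup>2)"
    using sum_squared_le_sum_of_squares[of "\<lambda>i. norm (z (b + i + L) - z (b + i))" "{..<L}"]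
    by (simp add: mult.commute)
  also have "(\<Sum>i<L. (norm (z (b + i + L) - z (b + i)))\<^sup>2)
      = (\<Sum>m\<in>{b..<b + L}. (norm (z (m + L) - z m))\<^sup>2)"
    by (rule sum.reindex_bij_witness[where i = "\<lambda>i. i - b" and j = "\<lambda>i. b + i"]) auto
  also have "real L * \<dots> \<le> real L * (\<Sum>m<T. (norm (z (m + L) - z m))\<^sup>2)"
    using assms by (intro mult_left_mono sum_mono2) auto
  finally have "(norm ((\<Sum>i<L. z (b + L + i)) - (\<Sum>i<L. z (b + i))))\<^sup>2 / (real L)\<^sup>2
      \<le> (\<Sum>m<T. (norm (z (m + L) - z m))\<^sup>2) / real L"
    using assms(2) by (simp add: field_simps power2_eq_square)
  then show ?thesis
    by (intro real_le_rsqrt) (simp add: power_divide)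
qed

text \<open>
  Chaining: \<open>a + n\<close> lies in one half of the dyadic interval, and the average over a half differs from
  the average over the whole by half the difference between the averages over the two halves.
\<close>

lemma norm_diff_dyadic_avg_le:
  fixes z :: "nat \<Rightarrow> 'b::real_normed_vector"
  assumes "a + 2 ^ r \<le> T" "n < 2 ^ r"
  shows "norm (z (a + n) - (\<Sum>i<2 ^ r. z (a + i)) /\<^sub>R 2 ^ r)
           \<le> (\<Sum>j<r. sqrt ((\<Sum>m<T. (norm (z (m + 2 ^ j) - z m))\<^sup>2) / 2 ^ j) / 2)"
  using assms
proof (induction r arbitrary: a n)
  case 0
  then show ?case by simp
next
  case (Suc r)
  define L :: nat where "L = 2 ^ r"
  define s t where "s = (\<Sum>i<L. z (a + i))" and "t = (\<Sum>i<L. z (a + L + i))"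
  have L: "0 < L" "2 ^ Suc r = L + L" "real L = 2 ^ r"
    by (auto simp: L_def)
  have split: "(\<Sum>i<2 ^ Suc r. z (a + i)) = s + t"
  proof -
    have "(\<Sum>i<L + L. z (a + i)) = (\<Sum>i<L. z (a + i)) + (\<Sum>i\<in>{L..<L + L}. z (a + i))"
      by (subst lessThan_atLeast0, subst sum.atLeastLessThan_concat[symmetric, of 0 L])
         (auto simp: lessThan_atLeast0)
    also have "(\<Sum>i\<in>{L..<L + L}. z (a + i)) = t"
      unfolding t_def
      by (rule sum.reindex_bij_witness[where j = "\<lambda>i. i - L" and i = "\<lambda>i. L + i"])
         (auto simp: add_ac)
    finally show ?thesis unfolding L(2) s_def by simp
  qed
  have step: "norm (t - s) / 2 ^ r / 2 \<le> sqrt ((\<Sum>m<T. (norm (z (m + 2 ^ r) - z m))\<^sup>2) / 2 ^ r) / 2"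
    using norm_avg_diff_le[of a L T z] Suc.prems L unfolding s_def t_def by (simp add: L_def)
  have half: "norm (s /\<^sub>R 2 ^ r - (s + t) /\<^sub>R 2 ^ Suc r) = norm (t - s) / 2 ^ r / 2"
             "norm (t /\<^sub>R 2 ^ r - (s + t) /\<^sub>R 2 ^ Suc r) = norm (t - s) / 2 ^ r / 2"
  proof -
    have "s /\<^sub>R 2 ^ r - (s + t) /\<^sub>R 2 ^ Suc r = (- (1 / 2 ^ r / 2)) *\<^sub>R (t - s)"
      "t /\<^sub>R 2 ^ r - (s + t) /\<^sub>R 2 ^ Suc r = (1 / 2 ^ r / 2) *\<^sub>R (t - s)"
      by (auto simp: algebra_simps divide_simps scaleR_add_left[symmetric])
    then show "norm (s /\<^sub>R 2 ^ r - (s + t) /\<^sub>R 2 ^ Suc r) = norm (t - s) / 2 ^ r / 2"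
       "norm (t /\<^sub>R 2 ^ r - (s + t) /\<^sub>R 2 ^ Suc r) = norm (t - s) / 2 ^ r / 2"
      by (simp_all add: abs_mult)
  qed
  let ?R = "\<Sum>j<r. sqrt ((\<Sum>m<T. (norm (z (m + 2 ^ j) - z m))\<^sup>2) / 2 ^ j) / 2"
  \<comment> \<open>\<open>c\<close> is the average over the half that contains \<open>a + n\<close>.\<close>
  have "\<exists>c. norm (z (a + n) - c) \<le> ?R \<and> norm (c - (s + t) /\<^sub>R 2 ^ Suc r) = norm (t - s) / 2 ^ r / 2"
  proof (cases "n < L")
    case True
    then have "norm (z (a + n) - s /\<^sub>R 2 ^ r) \<le> ?R"
      using Suc.IH[of a n] Suc.prems by (simp add: L_def s_def)
    then show ?thesis using half by blast
  next
    case False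
    then have "norm (z (a + L + (n - L)) - t /\<^sub>R 2 ^ r) \<le> ?R"
      using Suc.IH[of "a + L" "n - L"] Suc.prems by (simp add: L_def t_def)
    then have "norm (z (a + n) - t /\<^sub>R 2 ^ r) \<le> ?R"
      using False by simp
    then show ?thesis using half by blast
  qed
  then obtain c where c: "norm (z (a + n) - c) \<le> ?R"
      "norm (c - (s + t) /\<^sub>R 2 ^ Suc r) = norm (t - s) / 2 ^ r / 2"
    by blast
  have "norm (z (a + n) - (s + t) /\<^sub>R 2 ^ Suc r)
      \<le> norm (z (a + n) - c) + norm (c - (s + t) /\<^sub>R 2 ^ Suc r)"
    using norm_triangle_ineq[of "z (a + n) - c" "c - (s + t) /\<^sub>R 2 ^ Suc r"] by simp
  with c step show ?case
    unfolding split by simp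
qed

lemma norm_diff_le_sum_dyadic_increments:
  fixes z :: "nat \<Rightarrow> 'b::real_normed_vector"
  assumes "n < 2 ^ r"
  shows "norm (z n - z 0) \<le> (\<Sum>j<r. sqrt ((\<Sum>m<2 ^ r. (norm (z (m + 2 ^ j) - z m))\<^sup>2) / 2 ^ j))"
proof -
  let ?c = "(\<Sum>i<2 ^ r. z (0 + i)) /\<^sub>R 2 ^ r"
  let ?R = "\<Sum>j<r. sqrt ((\<Sum>m<2 ^ r. (norm (z (m + 2 ^ j) - z m))\<^sup>2) / 2 ^ j)"
  have "norm (z (0 + i) - ?c) \<le> ?R / 2" if "i < 2 ^ r" for i
    using norm_diff_dyadic_avg_le[of 0 r "2 ^ r" i z] that by (simp add: sum_divide_distrib)
  from this[OF assms] this[of 0] norm_triangle_ineq4[of "z n - ?c" "z 0 - ?c"]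
  show ?thesis by simp
qed

section \<open>The growth rate\<close>

text \<open>
  The Cauchy-Schwarz inequality with weights \<open>j + 1\<close>: their reciprocals sum to a harmonic number, which
  for \<open>r\<close> dyadic scales is of order \<open>ln r\<close>. This is where the iterated logarithm comes from.
\<close>

lemma sum_sqrt_le_harmonic:
  fixes t :: "nat \<Rightarrow> real"
  assumes "\<And>j. 0 \<le> t j"
  shows "(\<Sum>j\<in>A. sqrt (t j)) \<le> sqrt ((\<Sum>j\<in>A. 1 / (real j + 1)) * (\<Sum>j\<in>A. (real j + 1) * t j))"
proof (rule real_le_rsqrt)
  have "(\<Sum>j\<in>A. sqrt (t j))\<^sup>2 = (\<Sum>j\<in>A. sqrt (1 / (real j + 1)) * sqrt ((real j + 1) * t j))\<^sup>2"
    by (intro arg_cong[where f = "\<lambda>x. x\<^sup>2"] sum.cong refl) (simp flip: real_sqrt_mult)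
  also have "\<dots> \<le> (\<Sum>j\<in>A. (sqrt (1 / (real j + 1)))\<^sup>2) * (\<Sum>j\<in>A. (sqrt ((real j + 1) * t j))\<^sup>2)"
    by (rule Cauchy_Schwarz_ineq_sum)
  also have "\<dots> = (\<Sum>j\<in>A. 1 / (real j + 1)) * (\<Sum>j\<in>A. (real j + 1) * t j)"
    using assms by simp
  finally show "(\<Sum>j\<in>A. sqrt (t j))\<^sup>2 \<le> \<dots>" .
qed

lemma sum_inverse_Suc_le_ln:
  assumes "0 < r"
  shows "(\<Sum>j<r. 1 / (real j + 1)) \<le> 1 + ln (real r)"
proof -
  have "(\<Sum>j<r. 1 / (real j + 1)) = harm r"
    unfolding harm_def
    by (rule sum.reindex_bij_witness[where i = "\<lambda>k. k - 1" and j = Suc]) (auto simp: field_simps)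
  then show ?thesis
    using euler_mascheroni_sequence_decreasing[of 1 r] assms by (simp add: harm_def)
qed

text \<open>
  The deterministic core. The scales below \<open>J\<close> contribute at most a constant times \<open>sqrt n\<close>, by
  \<open>bound\<close>; the others contribute at most \<open>sqrt (2 * e * n * ln (ln n))\<close> asymptotically, by \<open>small\<close>.
\<close>

lemma tendsto_zero_of_dyadic_energy:
  fixes z :: "nat \<Rightarrow> 'b::real_normed_vector"
  defines "W j n \<equiv> \<Sum>m<n. (real j + 1) / 2 ^ j * (norm (z (m + 2 ^ j) - z m))\<^sup>2"
  assumes z0: "z 0 = 0"
    and bound: "\<And>n K. 1 \<le> n \<Longrightarrow> (\<Sum>j<K. W j n) \<le> real n * B"
    and small: "\<And>e. 0 < e \<Longrightarrow> \<exists>J. \<forall>n\<ge>1. \<forall>K. (\<Sum>j\<in>{J..<K}. W j n) \<le> real n * e"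
  shows "(\<lambda>n. (1 / sqrt (real n * ln (ln (real n)))) *\<^sub>R z n) \<longlonglongrightarrow> 0"
proof (rule LIMSEQ_I)
  fix \<epsilon> :: real assume \<epsilon>: "0 < \<epsilon>"
  \<comment> \<open>This choice makes \<open>sqrt (2 * e)\<close>, the limit of the bound \<open>h\<close> below, equal to \<open>\<epsilon> / 2\<close>.\<close>
  define e where "e = \<epsilon>\<^sup>2 / 8"
  have e: "0 < e" using \<epsilon> by (simp add: e_def)
  obtain J where J: "\<And>n K. 1 \<le> n \<Longrightarrow> (\<Sum>j\<in>{J..<K}. W j n) \<le> real n * e"
    using small[OF e] by blast
  define H where "H = (\<Sum>j<J. 1 / (real j + 1))"
  have W0: "0 \<le> W j n" for j n
    by (auto simp: W_def intro!: sum_nonneg)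
  have H0: "0 \<le> H" by (auto simp: H_def intro!: sum_nonneg)
  have B0: "0 \<le> B" using bound[of 1 0] by simp
  define h where "h x = sqrt (2 * H * B * (1 / ln (ln x)))
     + sqrt (2 * e * ((1 + ln (1 + ln x / ln 2)) / ln (ln x)))" for x :: real
  have main: "norm (z n) \<le> sqrt (2 * real n * (H * B)) + sqrt (2 * real n * ((1 + ln (1 + ln (real n) / ln 2)) * e))"
    if n: "1 \<le> n" for n
  proof -
    obtain s where s: "2 ^ s \<le> n" "n < 2 ^ (s + 1)"
      using ex_power_ivl1[of 2 n] n by auto
    define r where "r = s + 1"
    define t where "t j = (\<Sum>m<2 ^ r. (norm (z (m + 2 ^ j) - z m))\<^sup>2) / 2 ^ j" for j
    have t0: "0 \<le> t j" for j
      by (auto simp: t_def intro!: sum_nonneg divide_nonneg_nonneg)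
    have tW: "(real j + 1) * t j = W j (2 ^ r)" for j
      by (simp add: t_def W_def sum_distrib_left sum_divide_distrib)
    have "2 ^ r \<le> 2 * n" using s by (simp add: r_def)
    then have pr: "2 ^ r \<le> 2 * real n"
      by (metis of_nat_le_iff of_nat_mult of_nat_numeral of_nat_power)
    have "real s * ln 2 = ln (2 ^ s)" by (simp add: ln_realpow)
    also have "\<dots> \<le> ln (real n)"
      using s(1) n by (subst ln_le_cancel_iff) (auto simp flip: of_nat_le_iff)
    finally have rl: "real r \<le> 1 + ln (real n) / ln 2"
      by (simp add: r_def field_simps)
    have "norm (z n) \<le> (\<Sum>j<r. sqrt (t j))"
      using norm_diff_le_sum_dyadic_increments[of n r z] s(2) z0 by (simp add: t_def r_def)
    also have "\<dots> \<le> (\<Sum>j\<in>{..<J} \<union> {J..<r}. sqrt (t j))"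
      by (intro sum_mono2) (auto simp: t0)
    also have "\<dots> = (\<Sum>j<J. sqrt (t j)) + (\<Sum>j\<in>{J..<r}. sqrt (t j))"
      by (intro sum.union_disjoint) auto
    also have "(\<Sum>j<J. sqrt (t j)) \<le> sqrt (2 * real n * (H * B))"
    proof -
      have "(\<Sum>j<J. sqrt (t j)) \<le> sqrt (H * (\<Sum>j<J. W j (2 ^ r)))"
        using sum_sqrt_le_harmonic[of t "{..<J}"] t0 by (simp add: tW H_def)
      also have "\<dots> \<le> sqrt (H * (2 * real n * B))"
      proof (intro real_sqrt_le_mono mult_left_mono H0)
        have "(\<Sum>j<J. W j (2 ^ r)) \<le> 2 ^ r * B"
          using bound[of "2 ^ r" J] by simp
        also have "\<dots> \<le> 2 * real n * B"
          using pr B0 by (intro mult_right_mono)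
        finally show "(\<Sum>j<J. W j (2 ^ r)) \<le> 2 * real n * B" .
      qed
      finally show ?thesis by (simp add: mult_ac)
    qed
    also have "(\<Sum>j\<in>{J..<r}. sqrt (t j))
        \<le> sqrt (2 * real n * ((1 + ln (1 + ln (real n) / ln 2)) * e))"
    proof -
      have "(\<Sum>j\<in>{J..<r}. sqrt (t j))
          \<le> sqrt ((\<Sum>j\<in>{J..<r}. 1 / (real j + 1)) * (\<Sum>j\<in>{J..<r}. W j (2 ^ r)))"
        using sum_sqrt_le_harmonic[of t "{J..<r}"] t0 by (simp add: tW)
      also have "\<dots> \<le> sqrt ((1 + ln (1 + ln (real n) / ln 2)) * (2 * real n * e))"
      proof (intro real_sqrt_le_mono mult_mono sum_nonneg W0)
        have "(\<Sum>j\<in>{J..<r}. 1 / (real j + 1)) \<le> (\<Sum>j<r. 1 / (real j + 1))"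
          by (intro sum_mono2) auto
        also have "\<dots> \<le> 1 + ln (real r)"
          by (rule sum_inverse_Suc_le_ln) (simp add: r_def)
        also have "\<dots> \<le> 1 + ln (1 + ln (real n) / ln 2)"
          using rl by (simp add: r_def)
        finally show "(\<Sum>j\<in>{J..<r}. 1 / (real j + 1)) \<le> 1 + ln (1 + ln (real n) / ln 2)" .
        have "(\<Sum>j\<in>{J..<r}. W j (2 ^ r)) \<le> 2 ^ r * e"
          using J[of "2 ^ r" r] by simp
        also have "\<dots> \<le> 2 * real n * e"
          using pr e by (intro mult_right_mono) auto
        finally show "(\<Sum>j\<in>{J..<r}. W j (2 ^ r)) \<le> 2 * real n * e" .
        show "0 \<le> 1 + ln (1 + ln (real n) / ln 2)"
          using n by (intro add_nonneg_nonneg ln_ge_zero) auto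
      qed
      finally show ?thesis by (simp add: mult_ac)
    qed
    finally show ?thesis by simp
  qed
  have "(\<lambda>n::nat. 1 / ln (ln (real n))) \<longlonglongrightarrow> 0"
    "(\<lambda>n::nat. (1 + ln (1 + ln (real n) / ln 2)) / ln (ln (real n))) \<longlonglongrightarrow> 1"
    by real_asymp+
  then have "(\<lambda>n::nat. h (real n)) \<longlonglongrightarrow> sqrt (2 * H * B * 0) + sqrt (2 * e * 1)"
    unfolding h_def by (intro tendsto_intros)
  moreover have "sqrt (2 * H * B * 0) + sqrt (2 * e * 1) < \<epsilon>"
  proof -
    have "2 * e = (\<epsilon> / 2)\<^sup>2" by (simp add: e_def power_divide)
    then have "sqrt (2 * e) = \<epsilon> / 2" using \<epsilon> by simp
    then show ?thesis using \<epsilon> by simp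
  qed
  ultimately have "eventually (\<lambda>n. h (real n) < \<epsilon>) sequentially"
    by (rule order_tendstoD)
  moreover have "eventually (\<lambda>n::nat. 0 < ln (ln (real n))) sequentially"
    by real_asymp
  ultimately have "eventually (\<lambda>n. norm ((1 / sqrt (real n * ln (ln (real n)))) *\<^sub>R z n) < \<epsilon>) sequentially"
    using eventually_ge_at_top[of 1]
  proof eventually_elim
    case (elim n)
    define l where "l = ln (ln (real n))"
    have l: "0 < l" "0 < real n" using elim by (auto simp: l_def)
    have "norm ((1 / sqrt (real n * l)) *\<^sub>R z n) = norm (z n) / sqrt (real n * l)"
      using l by simp
    also have "\<dots> \<le> (sqrt (2 * real n * (H * B))
        + sqrt (2 * real n * ((1 + ln (1 + ln (real n) / ln 2)) * e))) / sqrt (real n * l)"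
      using main elim l by (intro divide_right_mono) auto
    also have "\<dots> = sqrt (2 * real n * (H * B) / (real n * l))
        + sqrt (2 * real n * ((1 + ln (1 + ln (real n) / ln 2)) * e) / (real n * l))"
      by (simp only: add_divide_distrib real_sqrt_divide)
    also have "\<dots> = h (real n)"
      using l(2) unfolding h_def l_def[symmetric] by (simp add: mult_ac)
    finally show ?case using elim by (simp add: l_def)
  qed
  then show "\<exists>N. \<forall>n\<ge>N. norm ((1 / sqrt (real n * ln (ln (real n)))) *\<^sub>R z n - 0) < \<epsilon>"
    by (simp add: eventually_sequentially)
qed

section \<open>From the weighted series to dyadic times\<close>

lemma summable_dyadic_blocks:
  fixes b :: "nat \<Rightarrow> real"
  assumes "\<And>k. 0 \<le> b k" "summable b"
  shows "summable (\<lambda>j. \<Sum>k\<in>{2 ^ j..<2 ^ (j + 1)}. b k)"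
proof (rule summableI_nonneg_bounded)
  show "0 \<le> (\<Sum>k\<in>{2 ^ j..<2 ^ (j + 1)}. b k)" for j
    using assms by (intro sum_nonneg)
  show "(\<Sum>j<J. \<Sum>k\<in>{2 ^ j..<2 ^ (j + 1)}. b k) \<le> suminf b" for J
  proof -
    have "(\<Sum>j<J. \<Sum>k\<in>{2 ^ j..<2 ^ (j + 1)}. b k) = (\<Sum>k\<in>{1..<2 ^ J}. b k)"
    proof (induction J)
      case (Suc J)
      then show ?case
        by (simp add: sum.atLeastLessThan_concat)
    qed simp
    also have "\<dots> \<le> suminf b"
      using assms by (intro sum_le_suminf) auto
    finally show ?thesis .
  qed
qed

text \<open>
  Averaging \<open>quasi\<close> over \<open>k\<close> in the dyadic block that starts at \<open>n = 2 ^ j\<close> puts both \<open>k\<close> and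
  \<open>k + n\<close> between \<open>2 ^ j\<close> and \<open>2 ^ (j + 2)\<close>. There the weight \<open>ln k / k\<^sup>2\<close> is comparable
  to \<open>(j + 1) / 4 ^ j\<close>, so the \<open>j\<close>-th term is at most a constant times two consecutive blocks of
  the given series. Taking \<open>k\<close> of the same size as \<open>n\<close>, rather than splitting \<open>n\<close> into smaller
  parts, is what keeps the comparison local.
\<close>

lemma summable_dyadic_of_quasi_subadditive:
  fixes q :: "nat \<Rightarrow> real"
  assumes q0: "\<And>n. 0 \<le> q n"
    and quasi: "\<And>n k. q n \<le> 2 * q (k + n) + 2 * q k"
    and sm: "summable (\<lambda>n. ln (real n) * q n / (real n)\<^sup>2)"
  shows "summable (\<lambda>j. (real j + 1) * q (2 ^ j) / 2 ^ j)"
proof -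
  define b where "b k = ln (real k) * q k / (real k)\<^sup>2" for k
  define A where "A j = (\<Sum>k\<in>{2 ^ j..<2 ^ (j + 1)}. b k)" for j
  define C where "C = 64 / ln (2::real)"
  have b0: "0 \<le> b k" for k
    using q0[of k] by (cases "k = 0") (auto simp: b_def intro!: divide_nonneg_nonneg mult_nonneg_nonneg)
  have A: "summable A"
    unfolding A_def using sm b0 by (intro summable_dyadic_blocks) (auto simp: b_def[abs_def])
  have qb: "(real j + 1) / 4 ^ j * q k \<le> C / 2 * b k"
    if j: "1 \<le> j" and k: "2 ^ j \<le> k" "k < 2 ^ (j + 2)" for j k
  proof -
    have k': "2 ^ j \<le> real k" "real k \<le> 2 ^ (j + 2)"
      using k by (metis of_nat_le_iff of_nat_numeral of_nat_power less_imp_le)+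
    have kp: "0 < real k" using k'(1) by (rule less_le_trans[rotated]) simp
    have "(real k)\<^sup>2 \<le> (2 ^ (j + 2))\<^sup>2"
      using k' by (intro power_mono) auto
    also have "\<dots> = 16 * 4 ^ j"
      by (simp add: power_mult_distrib power2_eq_square flip: power_mult_distrib)
    finally have k2: "(real k)\<^sup>2 \<le> 16 * 4 ^ j" .
    have "(real j + 1) / 2 * ln 2 \<le> real j * ln 2"
      using j by (intro mult_right_mono) auto
    also have "\<dots> = ln (2 ^ j)" by (simp add: ln_realpow)
    also have "\<dots> \<le> ln (real k)"
      using k' kp by (subst ln_le_cancel_iff) auto
    finally have l: "(real j + 1) / 2 * ln 2 \<le> ln (real k)" .
    have "(real j + 1) / 4 ^ j * q k = (C / 2) * ((real j + 1) / 2 * ln 2 * q k / (16 * 4 ^ j))"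
      by (simp add: C_def field_simps)
    also have "\<dots> \<le> (C / 2) * b k"
      unfolding b_def using k2 l kp q0[of k]
      by (intro mult_left_mono frac_le mult_right_mono) (auto simp: C_def intro!: mult_nonneg_nonneg)
    finally show ?thesis .
  qed
  have "(real j + 1) * q (2 ^ j) / 2 ^ j \<le> C * (A j + A (Suc j))" if j: "1 \<le> j" for j
  proof -
    let ?a = "(real j + 1) / 4 ^ j"
    have "(\<Sum>k\<in>{2 ^ j..<2 ^ (j + 1) :: nat}. q (2 ^ j))
        \<le> (\<Sum>k\<in>{2 ^ j..<2 ^ (j + 1)}. 2 * q (k + 2 ^ j) + 2 * q k)"
      by (intro sum_mono quasi)
    then have avg: "2 ^ j * q (2 ^ j) \<le> (\<Sum>k\<in>{2 ^ j..<2 ^ (j + 1)}. 2 * q (k + 2 ^ j) + 2 * q k)"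
      by simp
    have "(\<Sum>k\<in>{2 ^ j..<2 ^ (j + 1)}. b (k + 2 ^ j)) = (\<Sum>k\<in>{2 ^ j + 2 ^ j..<2 ^ (j + 1) + 2 ^ j}. b k)"
      by (rule sum.shift_bounds_nat_ivl[symmetric])
    also have "\<dots> \<le> A (Suc j)"
      unfolding A_def using b0 by (intro sum_mono2) auto
    finally have shift: "(\<Sum>k\<in>{2 ^ j..<2 ^ (j + 1)}. b (k + 2 ^ j)) \<le> A (Suc j)" .
    have "(real j + 1) * q (2 ^ j) / 2 ^ j = ?a * (2 ^ j * q (2 ^ j))"
      using power_mult_distrib[of "2::real" 2 j] by (simp add: field_simps)
    also have "\<dots> \<le> ?a * (\<Sum>k\<in>{2 ^ j..<2 ^ (j + 1)}. 2 * q (k + 2 ^ j) + 2 * q k)"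
      using avg by (rule mult_left_mono) simp
    also have "\<dots> = 2 * (\<Sum>k\<in>{2 ^ j..<2 ^ (j + 1)}. ?a * q (k + 2 ^ j))
        + 2 * (\<Sum>k\<in>{2 ^ j..<2 ^ (j + 1)}. ?a * q k)"
      by (simp add: sum.distrib sum_distrib_left algebra_simps)
    also have "\<dots> \<le> 2 * (\<Sum>k\<in>{2 ^ j..<2 ^ (j + 1)}. C / 2 * b (k + 2 ^ j))
        + 2 * (\<Sum>k\<in>{2 ^ j..<2 ^ (j + 1)}. C / 2 * b k)"
      using j by (intro add_mono mult_left_mono sum_mono qb) auto
    also have "\<dots> = C * (A j + (\<Sum>k\<in>{2 ^ j..<2 ^ (j + 1)}. b (k + 2 ^ j)))"
      by (simp add: A_def sum_distrib_left algebra_simps)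
    also have "\<dots> \<le> C * (A j + A (Suc j))"
      using shift by (intro mult_left_mono add_left_mono) (auto simp: C_def)
    finally show ?thesis .
  qed
  then have "\<exists>N. \<forall>j\<ge>N. norm ((real j + 1) * q (2 ^ j) / 2 ^ j) \<le> C * (A j + A (Suc j))"
    using q0 by (intro exI[of _ 1]) auto
  moreover have "summable (\<lambda>j. C * (A j + A (Suc j)))"
    using A by (intro summable_mult summable_add) (auto simp: summable_Suc_iff)
  ultimately show ?thesis
    by (rule summable_comparison_test)
qed

section \<open>Ergodic sums of square integrable functions\<close>

lemma ergodic_sum_add:
  fixes f :: "'a \<Rightarrow> 'b::ab_group_add"
  shows "ergodic_sum \<theta> f (m + n) x = ergodic_sum \<theta> f m x + ergodic_sum \<theta> f n ((\<theta> ^^ m) x)"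
proof -
  have "ergodic_sum \<theta> f n ((\<theta> ^^ m) x) = (\<Sum>k\<in>{m + 1..m + n}. f ((\<theta> ^^ k) x))"
    unfolding ergodic_sum_def
    by (rule sum.reindex_bij_witness[where i = "\<lambda>k. k - m" and j = "\<lambda>k. m + k"])
       (auto simp: funpow_add add.commute[of m])
  moreover have "{1..m + n} = {1..m} \<union> {m + 1..m + n}"
    by auto
  ultimately show ?thesis
    unfolding ergodic_sum_def by (simp add: sum.union_disjoint)
qed

lemma measurable_ergodic_sum:
  fixes f :: "'a \<Rightarrow> 'b::euclidean_space"
  assumes "measure_preserving M \<theta>" and [measurable]: "f \<in> borel_measurable M"
  shows "ergodic_sum \<theta> f n \<in> borel_measurable M"
proof -
  note [measurable] = measurable_measure_preserving_funpow[OF assms(1)]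
  show ?thesis unfolding ergodic_sum_def[abs_def] by measurable
qed

lemma norm_square_add_le:
  fixes a b :: "'b::real_normed_vector"
  shows "(norm (a + b))\<^sup>2 \<le> 2 * (norm a)\<^sup>2 + 2 * (norm b)\<^sup>2"
proof -
  have "(norm (a + b))\<^sup>2 \<le> (norm a + norm b)\<^sup>2"
    by (intro power_mono norm_triangle_ineq norm_ge_zero)
  also have "\<dots> \<le> 2 * (norm a)\<^sup>2 + 2 * (norm b)\<^sup>2"
    using sum_squares_bound[of "norm a" "norm b"] by (simp add: power2_sum)
  finally show ?thesis .
qed

lemma integrable_norm_square_ergodic_sum:
  fixes f :: "'a \<Rightarrow> 'b::euclidean_space"
  assumes mp: "measure_preserving M \<theta>" and f: "in_L2 M f"
  shows "integrable M (\<lambda>x. (norm (ergodic_sum \<theta> f n x))\<^sup>2)"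
proof (induction n)
  case 0
  show ?case by (simp add: ergodic_sum_def)
next
  case (Suc n)
  have fm: "f \<in> borel_measurable M" and fi: "integrable M (\<lambda>x. (norm (f x))\<^sup>2)"
    using f by (auto simp: in_L2_def)
  note [measurable] = measurable_ergodic_sum[OF mp fm]
  show ?case
  proof (rule Bochner_Integration.integrable_bound)
    show "integrable M (\<lambda>x. 2 * (norm (ergodic_sum \<theta> f n x))\<^sup>2 + 2 * (norm (f ((\<theta> ^^ Suc n) x)))\<^sup>2)"
      using Suc integrable_measure_preserving_funpow[OF mp fi, of "Suc n"] by auto
    show "AE x in M. norm ((norm (ergodic_sum \<theta> f (Suc n) x))\<^sup>2)
        \<le> norm (2 * (norm (ergodic_sum \<theta> f n x))\<^sup>2 + 2 * (norm (f ((\<theta> ^^ Suc n) x)))\<^sup>2)"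
      using norm_square_add_le by (intro AE_I2) (simp add: ergodic_sum_def)
  qed measurable
qed

text \<open>
  \<open>S\<^sub>n \<circ> \<theta>\<^sup>k = S\<^sub>k\<^sub>+\<^sub>n - S\<^sub>k\<close>, and the left-hand side has the same square integral as \<open>S\<^sub>n\<close>.
\<close>

lemma integral_norm_square_ergodic_sum_le:
  fixes f :: "'a \<Rightarrow> 'b::euclidean_space"
  assumes mp: "measure_preserving M \<theta>" and f: "in_L2 M f"
  defines "q n \<equiv> \<integral>x. (norm (ergodic_sum \<theta> f n x))\<^sup>2 \<partial>M"
  shows "q n \<le> 2 * q (k + n) + 2 * q k"
proof -
  have fm: "f \<in> borel_measurable M" using f by (simp add: in_L2_def)
  note [measurable] = measurable_ergodic_sum[OF mp fm]
  note int = integrable_norm_square_ergodic_sum[OF mp f]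
  have "q n = (\<integral>x. (norm (ergodic_sum \<theta> f n ((\<theta> ^^ k) x)))\<^sup>2 \<partial>M)"
    unfolding q_def by (rule integral_measure_preserving_funpow[OF mp, symmetric]) measurable
  also have "\<dots> \<le> (\<integral>x. 2 * (norm (ergodic_sum \<theta> f (k + n) x))\<^sup>2 + 2 * (norm (ergodic_sum \<theta> f k x))\<^sup>2 \<partial>M)"
  proof (intro integral_mono)
    show "integrable M (\<lambda>x. (norm (ergodic_sum \<theta> f n ((\<theta> ^^ k) x)))\<^sup>2)"
      by (rule integrable_measure_preserving_funpow[OF mp int])
    show "(norm (ergodic_sum \<theta> f n ((\<theta> ^^ k) x)))\<^sup>2
        \<le> 2 * (norm (ergodic_sum \<theta> f (k + n) x))\<^sup>2 + 2 * (norm (ergodic_sum \<theta> f k x))\<^sup>2" for x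
      using norm_square_add_le[of "ergodic_sum \<theta> f (k + n) x" "- ergodic_sum \<theta> f k x"]
      by (simp add: ergodic_sum_add)
  qed (use int in auto)
  also have "\<dots> = 2 * q (k + n) + 2 * q k"
    using int by (simp add: q_def)
  finally show ?thesis .
qed

text \<open>
  This applies the maximal inequality to the tails of \<open>\<Sum>\<^sub>j w\<^sub>j\<close>. Truncating the sum over \<open>j\<close> at \<open>K\<close> in
  the conclusion keeps everything real-valued, although the full sum may be infinite on a null set.
  The starting scale \<open>p i\<close> is a parameter because two choices are needed: the constant \<open>0\<close> with growing
  thresholds \<open>l\<close> for boundedness, and \<open>p i = i\<close> with a constant threshold for smallness.
\<close>

lemma AE_exists_small_tail_average:
  fixes w :: "nat \<Rightarrow> 'a \<Rightarrow> real" and l :: "nat \<Rightarrow> real" and p :: "nat \<Rightarrow> nat"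
  assumes mp: "measure_preserving M \<theta>"
    and w: "\<And>j. integrable M (w j)" "\<And>j x. 0 \<le> w j x"
    and sm: "summable (\<lambda>j. \<integral>x. w j x \<partial>M)"
    and l: "\<And>i. 0 < l i"
    and small: "\<And>e. 0 < e \<Longrightarrow> \<exists>i. (\<Sum>j. \<integral>x. w (j + p i) x \<partial>M) \<le> e * l i"
  shows "AE x in M. \<exists>i. \<forall>n\<ge>1. \<forall>K. (\<Sum>j\<in>{p i..<K}. \<Sum>m<n. w j ((\<theta> ^^ m) x)) \<le> real n * l i"
proof -
  have [measurable]: "w j \<in> borel_measurable M" for j
    using w(1) by auto
  define u where "u i x = (\<Sum>j. ennreal (w (j + p i) x))" for i x
  have u: "u i \<in> borel_measurable M" for i
    unfolding u_def by measurable
  have iu: "(\<integral>\<^sup>+x. u i x \<partial>M) = ennreal (\<Sum>j. \<integral>x. w (j + p i) x \<partial>M)" for i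
  proof -
    have "(\<integral>\<^sup>+x. u i x \<partial>M) = (\<Sum>j. \<integral>\<^sup>+x. ennreal (w (j + p i) x) \<partial>M)"
      unfolding u_def by (rule nn_integral_suminf) auto
    also have "\<dots> = (\<Sum>j. ennreal (\<integral>x. w (j + p i) x \<partial>M))"
      using w by (simp add: nn_integral_eq_integral)
    also have "\<dots> = ennreal (\<Sum>j. \<integral>x. w (j + p i) x \<partial>M)"
      using w sm by (intro suminf_ennreal2) (auto intro: summable_ignore_initial_segment[OF sm])
    finally show ?thesis .
  qed
  have "AE x in M. \<exists>i. \<forall>n\<ge>1. (\<Sum>m<n. u i ((\<theta> ^^ m) x)) \<le> ennreal (real n * l i)"
  proof (rule AE_exists_ergodic_average_bound[OF mp u l])
    show "\<exists>i. (\<integral>\<^sup>+x. u i x \<partial>M) \<le> ennreal (e * l i)" if "0 < e" for e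
      using small[OF that] unfolding iu by (auto intro: ennreal_leI)
  qed
  then show ?thesis
  proof eventually_elim
    case (elim x)
    then obtain i where i: "\<And>n. 1 \<le> n \<Longrightarrow> (\<Sum>m<n. u i ((\<theta> ^^ m) x)) \<le> ennreal (real n * l i)"
      by blast
    have "(\<Sum>j\<in>{p i..<K}. \<Sum>m<n. w j ((\<theta> ^^ m) x)) \<le> real n * l i" if n: "1 \<le> n" for n K
    proof -
      have "(\<Sum>j\<in>{p i..<K}. \<Sum>m<n. w j ((\<theta> ^^ m) x)) = (\<Sum>m<n. \<Sum>j\<in>{p i..<K}. w j ((\<theta> ^^ m) x))"
        by (rule sum.swap)
      also have "\<dots> = (\<Sum>m<n. \<Sum>j<K - p i. w (j + p i) ((\<theta> ^^ m) x))"
        by (intro sum.cong refl sum.reindex_bij_witness[where i = "\<lambda>j. j + p i" and j = "\<lambda>j. j - p i"]) auto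
      also have "ennreal \<dots> = (\<Sum>m<n. \<Sum>j<K - p i. ennreal (w (j + p i) ((\<theta> ^^ m) x)))"
        using w(2) by (simp add: sum_ennreal sum_nonneg)
      also have "\<dots> \<le> (\<Sum>m<n. u i ((\<theta> ^^ m) x))"
        unfolding u_def by (intro sum_mono sum_le_suminf) auto
      also have "\<dots> \<le> ennreal (real n * l i)"
        by (rule i[OF n])
      finally show ?thesis
        using l[of i] by (simp add: ennreal_le_iff)
    qed
    then show ?case by blast
  qed
qed

theorem theorem4p4:
  fixes M :: "'a measure"
    and \<theta> :: "'a \<Rightarrow> 'a"
    and f :: "'a \<Rightarrow> 'k::{real_normed_field, euclidean_space}"
  assumes "measure_preserving M \<theta>"
    and "in_L2 M f"
    and "(\<lambda>n::nat. ln (real n) * (L2_norm M (ergodic_sum \<theta> f n))\<^sup>2 / (real n)\<^sup>2) summable_on {3..}"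
  shows "AE x in M. (\<lambda>n::nat. (1 / sqrt (real n * ln (ln (real n)))) *\<^sub>R ergodic_sum \<theta> f n x)
           \<longlonglongrightarrow> 0"
proof -
  define S where "S = ergodic_sum \<theta> f"
  define q where "q n = (\<integral>x. (norm (S n x))\<^sup>2 \<partial>M)" for n
  define w where "w j x = (real j + 1) / 2 ^ j * (norm (S (2 ^ j) x))\<^sup>2" for j x
  have int: "integrable M (\<lambda>x. (norm (S n x))\<^sup>2)" for n
    unfolding S_def by (rule integrable_norm_square_ergodic_sum[OF assms(1,2)])
  have q0: "0 \<le> q n" for n
    by (simp add: q_def)
  have "(\<lambda>n. ln (real n) * q n / (real n)\<^sup>2) summable_on ({..<3} \<union> {3..})"
    using assms(3) q0
    by (intro summable_on_Un_disjoint) (auto simp: q_def S_def L2_norm_def)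
  also have "{..<3} \<union> {3..} = (UNIV :: nat set)"
    by auto
  finally have "summable (\<lambda>n. ln (real n) * q n / (real n)\<^sup>2)"
    by (rule summable_on_imp_summable)
  moreover have "q n \<le> 2 * q (k + n) + 2 * q k" for n k
    unfolding q_def S_def by (rule integral_norm_square_ergodic_sum_le[OF assms(1,2)])
  ultimately have "summable (\<lambda>j. (real j + 1) * q (2 ^ j) / 2 ^ j)"
    using q0 by (intro summable_dyadic_of_quasi_subadditive)
  then have sm: "summable (\<lambda>j. \<integral>x. w j x \<partial>M)"
    by (simp add: w_def q_def)
  have w: "\<And>j. integrable M (w j)" "\<And>j x. 0 \<le> w j x"
    using int by (auto simp: w_def[abs_def])
  \<comment> \<open>Boundedness of the averages over all scales, with the integer bound \<open>i + 1\<close> depending on \<open>x\<close>.\<close>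
  have "AE x in M. \<exists>i::nat. \<forall>n\<ge>1. \<forall>K. (\<Sum>j\<in>{0..<K}. \<Sum>m<n. w j ((\<theta> ^^ m) x)) \<le> real n * (real i + 1)"
  proof (rule AE_exists_small_tail_average[OF assms(1) w sm, where p = "\<lambda>_. 0"])
    fix e :: real assume "0 < e"
    then obtain i :: nat where "(\<Sum>j. \<integral>x. w (j + 0) x \<partial>M) < real i * e"
      using reals_Archimedean3 by blast
    then show "\<exists>i. (\<Sum>j. \<integral>x. w (j + 0) x \<partial>M) \<le> e * (real i + 1)"
      using \<open>0 < e\<close> by (intro exI[of _ i]) (simp add: algebra_simps)
  qed simp
  \<comment> \<open>Smallness of the averages over large scales, along a countable family of thresholds.\<close>
  moreover have "AE x in M. \<forall>k::nat. \<exists>i. \<forall>n\<ge>1. \<forall>K.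
      (\<Sum>j\<in>{i..<K}. \<Sum>m<n. w j ((\<theta> ^^ m) x)) \<le> real n * (1 / (real k + 1))"
    unfolding AE_all_countable
  proof (intro allI AE_exists_small_tail_average[OF assms(1) w sm])
    fix k :: nat and e :: real assume "0 < e"
    then have "0 < e * (1 / (real k + 1))" by simp
    from suminf_exist_split[OF this sm]
    obtain i where "norm (\<Sum>j. \<integral>x. w (j + i) x \<partial>M) < e * (1 / (real k + 1))"
      by blast
    then show "\<exists>i. (\<Sum>j. \<integral>x. w (j + i) x \<partial>M) \<le> e * (1 / (real k + 1))"
      by (intro exI[of _ i]) simp
  qed simp
  ultimately show ?thesis
  proof eventually_elim
    case (elim x)
    obtain i :: nat where i:
      "\<And>n K. 1 \<le> n \<Longrightarrow> (\<Sum>j\<in>{0..<K}. \<Sum>m<n. w j ((\<theta> ^^ m) x)) \<le> real n * (real i + 1)"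
      using elim(1) by blast
    have incr: "S (m + k) x - S m x = S k ((\<theta> ^^ m) x)" for m k
      by (simp add: S_def ergodic_sum_add)
    show ?case
      unfolding S_def[symmetric]
    proof (rule tendsto_zero_of_dyadic_energy, unfold incr w_def[symmetric])
      show "S 0 x = 0"
        by (simp add: S_def ergodic_sum_def)
      show "(\<Sum>j<K. \<Sum>m<n. w j ((\<theta> ^^ m) x)) \<le> real n * (real i + 1)" if "1 \<le> n" for n K
        using i[OF that, of K] by (simp add: atLeast0LessThan)
      fix e :: real assume "0 < e"
      then obtain k :: nat where k: "1 / (real k + 1) < e"
        using nat_approx_posE[of e] by (auto simp: add.commute)
      obtain J where J: "\<And>n K. 1 \<le> n \<Longrightarrow>
          (\<Sum>j\<in>{J..<K}. \<Sum>m<n. w j ((\<theta> ^^ m) x)) \<le> real n * (1 / (real k + 1))"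
        using elim(2) by blast
      have "(\<Sum>j\<in>{J..<K}. \<Sum>m<n. w j ((\<theta> ^^ m) x)) \<le> real n * e" if "1 \<le> n" for n K
        using J[OF that, of K] k mult_left_mono[of "1 / (real k + 1)" e "real n"] by linarith
      then show "\<exists>J. \<forall>n\<ge>1. \<forall>K. (\<Sum>j\<in>{J..<K}. \<Sum>m<n. w j ((\<theta> ^^ m) x)) \<le> real n * e"
        by blast
    qed
  qed
qed

end
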